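(* Let $k$ be a positive real number. A graded poset $P$ is $k$-Eulerian if and only if for every interval $[x,y]\subseteq P$ of positive even rank $m=\rho(x,y)$, $$L^{k,m}_{[1,m-1]}([x,y])=\sum_{T\subseteq[1,m-1]}\left(-\frac1{2k}\right)^{|T|}f_T([x,y])=0.$$
   Context: A graded poset is a finite poset with unique minimum $\hat 0$, unique maximum $\hat 1$, and a rank function $\rho$ with $\rho(\hat0)=0$ and $\rho(y)-\rho(x)=1$ when $y$ covers $x$; $\rho(x,y)=\rho(y)-\rho(x)$, and an interval $[x,y]$ is a graded poset of rank $\rho(x,y)$. For a graded poset $Q$ of rank $m$ and $T\subseteq[1,m-1]$, $f_T(Q)$ is the number of chains in $Q$ whose set of ranks is exactly $T$. For $S\subseteq[1,m-1]$, $L^{k,m}_S(Q)=(-1)^{m-1-|S|}\sum_{T\supseteq[1,m-1]\setminus S}(-\frac1{2k})^{|T|}f_T(Q)$. The $k$-Möbius function: $\mu_k([x,x])=1$ and, for $x<y$, $\mu_k([x,y])=-1-\frac1k\sum_{x<z<y}\mu_k([x,z])$; $P$ is $k$-Eulerian if $\mu_k([x,y])=(-1)^{\rho(x,y)}$ for all intervals $[x,y]$. *)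

theory Defs
  imports Complex_Main
begin

text \<open>
  A poset is a carrier \<open>P\<close> with an order relation \<open>r\<close>, as in \<^const>\<open>partial_order_on\<close>;
  \<open>(x, y) \<in> r\<close> reads \<open>x \<le> y\<close>.
\<close>

definition covers :: "'a set \<Rightarrow> 'a rel \<Rightarrow> 'a \<Rightarrow> 'a \<Rightarrow> bool" where
  "covers P r y x \<longleftrightarrow> x \<in> P \<and> y \<in> P \<and> (x, y) \<in> r \<and> x \<noteq> y \<and>
     \<not> (\<exists>z\<in>P. (x, z) \<in> r \<and> (z, y) \<in> r \<and> z \<noteq> x \<and> z \<noteq> y)"

text \<open>Minimum and maximum are unique by antisymmetry; \<open>\<rho>\<close> matters only on \<open>P\<close>.\<close>

definition graded_poset :: "'a set \<Rightarrow> 'a rel \<Rightarrow> ('a \<Rightarrow> nat) \<Rightarrow> bool" where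
  "graded_poset P r \<rho> \<longleftrightarrow>
     finite P \<and> partial_order_on P r \<and>
     (\<exists>b\<in>P. (\<forall>x\<in>P. (b, x) \<in> r) \<and> \<rho> b = 0) \<and>
     (\<exists>t\<in>P. \<forall>x\<in>P. (x, t) \<in> r) \<and>
     (\<forall>x y. covers P r y x \<longrightarrow> \<rho> y = \<rho> x + 1)"

definition interval :: "'a set \<Rightarrow> 'a rel \<Rightarrow> 'a \<Rightarrow> 'a \<Rightarrow> 'a set" where
  "interval P r x y = {z \<in> P. (x, z) \<in> r \<and> (z, y) \<in> r}"

definition interval_rel :: "'a set \<Rightarrow> 'a rel \<Rightarrow> 'a \<Rightarrow> 'a \<Rightarrow> 'a rel" where
  "interval_rel P r x y = Restr r (interval P r x y)"

text \<open>The rank function of an interval with minimum \<open>x\<close>; the subtraction does not truncate there.\<close>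

definition interval_rank :: "('a \<Rightarrow> nat) \<Rightarrow> 'a \<Rightarrow> 'a \<Rightarrow> nat" where
  "interval_rank \<rho> x z = \<rho> z - \<rho> x"

text \<open>The empty chain is counted, so the value at the empty set of ranks is 1.\<close>

definition flag_f :: "'a set \<Rightarrow> 'a rel \<Rightarrow> ('a \<Rightarrow> nat) \<Rightarrow> nat set \<Rightarrow> nat" where
  "flag_f Q r \<rho> T = card {C. C \<subseteq> Q \<and> C \<in> Chains r \<and> \<rho> ` C = T}"

definition flag_L ::
  "real \<Rightarrow> nat \<Rightarrow> nat set \<Rightarrow> 'a set \<Rightarrow> 'a rel \<Rightarrow> ('a \<Rightarrow> nat) \<Rightarrow> real" where
  "flag_L k m S Q r \<rho> =
     (-1) ^ (m - 1 - card S) *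
     (\<Sum>T | {1..m - 1} - S \<subseteq> T \<and> T \<subseteq> {1..m - 1}.
        (- 1 / (2 * k)) ^ card T * real (flag_f Q r \<rho> T))"

text \<open>
  The value at the interval \<open>[x, y]\<close> of \<open>P\<close>. The first branch, a dummy value when \<open>x \<le> y\<close> fails in
  a finite poset, makes the recursion well-founded.
\<close>

function k_moebius :: "real \<Rightarrow> 'a set \<Rightarrow> 'a rel \<Rightarrow> 'a \<Rightarrow> 'a \<Rightarrow> real" where
  "k_moebius k P r x y =
     (if \<not> (finite P \<and> partial_order_on P r \<and> x \<in> P \<and> y \<in> P \<and> (x, y) \<in> r) then 0
      else if x = y then 1
      else - 1 - (1 / k) * (\<Sum>z \<in> interval P r x y - {x, y}. k_moebius k P r x z))"
  by pat_completeness auto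
termination
proof (relation "measure (\<lambda>(k, P, r, x, y). card (interval P r x y))", goal_cases)
  case 1
  show ?case by simp
next
  case (2 k P r x y z)
  then have po: "finite P" "trans r" "antisym r" "(x, y) \<in> r" "(y, y) \<in> r" "y \<in> P"
    and z: "z \<in> P" "(z, y) \<in> r" "z \<noteq> y"
    by (auto simp: partial_order_on_def preorder_on_def refl_on_def interval_def)
  have "interval P r x z \<subseteq> interval P r x y"
    using po z by (auto simp: interval_def dest: transD)
  moreover have "y \<in> interval P r x y" "y \<notin> interval P r x z"
    using po z by (auto simp: interval_def dest: antisymD)
  ultimately have "interval P r x z \<subset> interval P r x y" by blast
  moreover have "finite (interval P r x y)" using po by (simp add: interval_def)
  ultimately show ?case by (simp add: psubset_card_mono)
qed

text \<open>The defining equation always applies, so it must not be unfolded by default.\<close>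

declare k_moebius.simps [simp del]

definition k_Eulerian :: "real \<Rightarrow> 'a set \<Rightarrow> 'a rel \<Rightarrow> ('a \<Rightarrow> nat) \<Rightarrow> bool" where
  "k_Eulerian k P r \<rho> \<longleftrightarrow>
     (\<forall>x\<in>P. \<forall>y\<in>P. (x, y) \<in> r \<longrightarrow> k_moebius k P r x y = (-1) ^ (\<rho> y - \<rho> x))"

end

theory Submission
  imports Defs
begin

text \<open>
  Summing over the maximal element of a chain shows that the sum in question equals
  \<open>- \<mu>\<^sub>2\<^sub>k([x, y])\<close>. In the incidence algebra, put \<open>a = 1 / (2 k)\<close>, let \<open>\<eta>\<close> be the strict zeta
  function, and let \<open>M\<close> and \<open>N\<close> be the strict parts of \<open>\<mu>\<^sub>k\<close> and \<open>\<mu>\<^sub>2\<^sub>k\<close>. The recursions read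
  \<open>M = - \<eta> / (1 + 2 a \<eta>)\<close> and \<open>N = - \<eta> / (1 + a \<eta>)\<close>, so that with \<open>g t = t / (1 - a t)\<close> one has
  \<open>M = g N\<close> and \<open>\<eta> = g (- N)\<close>. Twisting by the sign of the rank is an automorphism, written as a
  bar; \<open>k\<close>-Eulerian means that the bar of \<open>M\<close> is \<open>\<eta>\<close>, hence that the bar of \<open>N\<close> is \<open>- N\<close>, i.e. that
  \<open>N\<close> vanishes on intervals of even rank.
\<close>

section \<open>Finite posets with strictly increasing rank\<close>

locale ranked_finite_poset =
  fixes P :: "'a set" and r :: "'a rel" and \<rho> :: "'a \<Rightarrow> nat"
  assumes finite_P: "finite P"
    and po: "partial_order_on P r"
    and rank_less: "\<lbrakk>(x, y) \<in> r; x \<noteq> y\<rbrakk> \<Longrightarrow> \<rho> x < \<rho> y"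
begin

definition open_interval :: "'a \<Rightarrow> 'a \<Rightarrow> 'a set" where
  "open_interval x y = interval P r x y - {x, y}"

lemma r_in: "(x, y) \<in> r \<Longrightarrow> x \<in> P \<and> y \<in> P"
  using po by (auto simp: partial_order_on_def preorder_on_def refl_on_def)

lemma r_refl: "x \<in> P \<Longrightarrow> (x, x) \<in> r"
  using po by (auto simp: partial_order_on_def preorder_on_def refl_on_def)

lemma r_trans: "(x, y) \<in> r \<Longrightarrow> (y, z) \<in> r \<Longrightarrow> (x, z) \<in> r"
  using po by (auto simp: partial_order_on_def preorder_on_def dest: transD)

lemma r_antisym: "(x, y) \<in> r \<Longrightarrow> (y, x) \<in> r \<Longrightarrow> x = y"
  using po by (auto simp: partial_order_on_def dest: antisymD)

lemma mem_open_interval: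
  "z \<in> open_interval x y \<longleftrightarrow> (x, z) \<in> r \<and> (z, y) \<in> r \<and> z \<noteq> x \<and> z \<noteq> y"
  using r_in by (auto simp: open_interval_def interval_def)

lemma finite_open_interval: "finite (open_interval x y)"
  using finite_P by (simp add: open_interval_def interval_def)

lemma rank_open_interval:
  "z \<in> open_interval x y \<Longrightarrow> \<rho> x < \<rho> z \<and> \<rho> z < \<rho> y"
  using rank_less by (auto simp: mem_open_interval)

lemma open_interval_rel: "z \<in> open_interval x y \<Longrightarrow> (x, y) \<in> r \<and> x \<noteq> y"
  using r_trans rank_open_interval by (fastforce simp: mem_open_interval)

section \<open>The Moebius recursion and convolution over open intervals\<close>

lemma k_moebius_refl: "x \<in> P \<Longrightarrow> k_moebius k P r x x = 1"
  using finite_P po r_refl by (simp add: k_moebius.simps)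

lemma k_moebius_rec:
  assumes "(x, y) \<in> r" "x \<noteq> y"
  shows "k_moebius k P r x y = - 1 - 1 / k * (\<Sum>z\<in>open_interval x y. k_moebius k P r x z)"
  using assms finite_P po r_in[of x y]
  by (subst k_moebius.simps) (simp add: open_interval_def)

text \<open>Both sides range over the pairs with x < w < z < y. For products \<open>f w z\<close> =
  N(x,w) M(w,z) this is associativity, N(M\<eta>) = (NM)\<eta>.\<close>

lemma sum_open_interval_swap:
  fixes f :: "'a \<Rightarrow> 'a \<Rightarrow> real"
  shows "(\<Sum>w\<in>open_interval x y. \<Sum>z\<in>open_interval w y. f w z) =
    (\<Sum>z\<in>open_interval x y. \<Sum>w\<in>open_interval x z. f w z)"
proof -
  have left: "open_interval w y = {z \<in> open_interval x y. w \<in> open_interval x z}"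
    if "w \<in> open_interval x y" for w
    using that r_trans r_antisym unfolding mem_open_interval set_eq_iff by blast
  have right: "open_interval x z = {w \<in> open_interval x y. w \<in> open_interval x z}"
    if "z \<in> open_interval x y" for z
    using that r_trans r_antisym unfolding mem_open_interval set_eq_iff by blast
  have "(\<Sum>w\<in>open_interval x y. \<Sum>z\<in>open_interval w y. f w z) =
    (\<Sum>w\<in>open_interval x y. \<Sum>z | z \<in> open_interval x y \<and> w \<in> open_interval x z. f w z)"
    by (rule sum.cong[OF refl], subst left) auto
  also have "\<dots> =
    (\<Sum>z\<in>open_interval x y. \<Sum>w | w \<in> open_interval x y \<and> w \<in> open_interval x z. f w z)"
    by (rule sum.swap_restrict) (simp_all add: finite_open_interval)
  also have "\<dots> = (\<Sum>z\<in>open_interval x y. \<Sum>w\<in>open_interval x z. f w z)"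
    by (rule sum.cong[OF refl], subst (2) right) auto
  finally show ?thesis .
qed

text \<open>The identity \<open>M = N + a N M\<close>.\<close>

lemma k_moebius_double:
  assumes "k \<noteq> 0" "(x, y) \<in> r" "x \<noteq> y"
  shows "k_moebius k P r x y = k_moebius (2 * k) P r x y + 1 / (2 * k) *
    (\<Sum>z\<in>open_interval x y. k_moebius (2 * k) P r x z * k_moebius k P r z y)"
  using assms(2,3)
proof (induction "\<rho> y" arbitrary: y rule: less_induct)
  case less
  let ?M = "k_moebius k P r" and ?N = "k_moebius (2 * k) P r"
  define a where "a = 1 / (2 * k)"
  have k: "1 / k = 2 * a"
    by (simp add: a_def)
  \<comment> \<open>\<open>SN\<close> and \<open>SS\<close> are the values of N\<eta> and NM\<eta>
    at [x,y]; both sides of the claim get expanded in terms of them.\<close>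
  define SN where "SN = (\<Sum>z\<in>open_interval x y. ?N x z)"
  define SS where "SS = (\<Sum>z\<in>open_interval x y. \<Sum>w\<in>open_interval x z. ?N x w * ?M w z)"
  have "?M x z = ?N x z + a * (\<Sum>w\<in>open_interval x z. ?N x w * ?M w z)"
    if "z \<in> open_interval x y" for z
    using less.hyps[of z] that rank_open_interval[OF that]
    unfolding mem_open_interval a_def by auto
  hence "(\<Sum>z\<in>open_interval x y. ?M x z) = SN + a * SS"
    by (simp add: SN_def SS_def sum.distrib sum_distrib_left)
  hence M: "?M x y = - 1 - 2 * a * (SN + a * SS)"
    by (simp add: k_moebius_rec[OF less.prems] flip: k)
  have N: "?N x y = - 1 - a * SN"
    unfolding k_moebius_rec[OF less.prems] SN_def a_def ..
  \<comment> \<open>Here the recursion for M is based at the middle point w, so the resulting double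
    sum has w outermost and must be swapped to become \<open>SS\<close>.\<close>
  have "?N x w * ?M w y = - ?N x w - 2 * a * (\<Sum>z\<in>open_interval w y. ?N x w * ?M w z)"
    if "w \<in> open_interval x y" for w
  proof -
    have "?M w y = - 1 - 2 * a * (\<Sum>z\<in>open_interval w y. ?M w z)"
      using that k_moebius_rec[of w y k] unfolding k mem_open_interval by simp
    thus ?thesis
      by (simp add: right_diff_distrib mult.left_commute flip: sum_distrib_left)
  qed
  hence "(\<Sum>w\<in>open_interval x y. ?N x w * ?M w y) = (\<Sum>w\<in>open_interval x y.
      - ?N x w - 2 * a * (\<Sum>z\<in>open_interval w y. ?N x w * ?M w z))"
    by (rule sum.cong[OF refl])
  also have "\<dots> = - SN - 2 * a * SS"
    unfolding SN_def SS_def sum_open_interval_swap[symmetric]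
    by (simp add: sum_subtractf sum_negf flip: sum_distrib_left)
  finally have NM: "(\<Sum>w\<in>open_interval x y. ?N x w * ?M w y) = - SN - 2 * a * SS" .
  show ?case
    unfolding M N a_def[symmetric] NM by (simp add: algebra_simps)
qed

section \<open>Sign twist and the Eulerian condition\<close>

text \<open>Rank is additive, so the sign is multiplicative along x < z < y; a sign is its own
  inverse, which allows solving for the factor of [z,y].\<close>

lemma sign_rank_split:
  assumes "z \<in> open_interval x y"
  shows "(- 1 :: real) ^ (\<rho> y - \<rho> z) = (- 1) ^ (\<rho> y - \<rho> x) * (- 1) ^ (\<rho> z - \<rho> x)"
proof -
  have "\<rho> y - \<rho> x = (\<rho> y - \<rho> z) + (\<rho> z - \<rho> x)"
    using rank_open_interval[OF assms] by simp
  thus ?thesis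
    by (simp add: power_add flip: power_mult_distrib)
qed

text \<open>Write s for the sign of [x,y]. Each direction derives M = N + s(1 + N) at [x,y] by
  rewriting the terms of NM; there M = s is equivalent to N = -sN. The latter is void for odd rank
  and says N = 0 for even rank.\<close>

lemma k_Eulerian_iff_k_moebius_double_eq_0:
  assumes "k \<noteq> 0"
  shows "k_Eulerian k P r \<rho> \<longleftrightarrow>
    (\<forall>x y. (x, y) \<in> r \<and> x \<noteq> y \<and> even (\<rho> y - \<rho> x) \<longrightarrow> k_moebius (2 * k) P r x y = 0)"
    (is "_ \<longleftrightarrow> ?vanish")
proof
  let ?M = "k_moebius k P r" and ?N = "k_moebius (2 * k) P r"
  let ?s = "\<lambda>x y. (- 1 :: real) ^ (\<rho> y - \<rho> x)"
  define a where "a = 1 / (2 * k)"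
  have N: "?N x y = - 1 - a * (\<Sum>z\<in>open_interval x y. ?N x z)" if "(x, y) \<in> r" "x \<noteq> y" for x y
    unfolding k_moebius_rec[OF that] a_def ..
  note M = k_moebius_double[OF assms, folded a_def]
  {
    assume E: "k_Eulerian k P r \<rho>"
    have M_eq: "?M x y = ?s x y" if "(x, y) \<in> r" for x y
      using E that r_in unfolding k_Eulerian_def by blast
    \<comment> \<open>M is known on all intervals, and the twist of N is needed at the shorter
      [x,z]: the induction keeps x and moves y.\<close>
    have twist: "?N x y = - ?s x y * ?N x y" if "(x, y) \<in> r" "x \<noteq> y" for x y
      using that
    proof (induction "\<rho> y" arbitrary: y rule: less_induct)
      case less
      have "?N x z * ?M z y = - ?s x y * ?N x z" if z: "z \<in> open_interval x y" for z
      proof -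
        have N_eq: "?N x z = - ?s x z * ?N x z"
          using less.hyps[of z] rank_open_interval[OF z] z unfolding mem_open_interval by blast
        have "?M z y = ?s x y * ?s x z"
          using M_eq[of z y] z sign_rank_split[OF z] by (simp add: mem_open_interval)
        hence "?N x z * ?M z y = ?s x y * (?s x z * ?N x z)"
          by (simp only: mult_ac)
        also have "?s x z * ?N x z = - ?N x z"
          using N_eq by linarith
        finally show ?thesis
          by simp
      qed
      hence "?M x y = ?N x y - ?s x y * (a * (\<Sum>z\<in>open_interval x y. ?N x z))"
        unfolding M[OF less.prems]
        by (simp add: sum_negf flip: sum_distrib_left)
      also have "a * (\<Sum>z\<in>open_interval x y. ?N x z) = - 1 - ?N x y"
        using N[OF less.prems] by simp
      finally show ?case
        using M_eq[OF less.prems(1)] by (simp add: algebra_simps)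
    qed
    show ?vanish
      using twist by fastforce
  next
    assume V: ?vanish
    have twist: "?N x y = - ?s x y * ?N x y" if "(x, y) \<in> r" "x \<noteq> y" for x y
      using V that by (cases "even (\<rho> y - \<rho> x)") auto
    \<comment> \<open>Now the twist of N is known throughout, and M is needed at [z,y]: the
      induction keeps y and moves x, hence runs on the length.\<close>
    have "?M x y = ?s x y" if "(x, y) \<in> r" "x \<noteq> y" for x y
      using that
    proof (induction "\<rho> y - \<rho> x" arbitrary: x rule: less_induct)
      case less
      have "?N x z * ?M z y = - ?s x y * ?N x z" if z: "z \<in> open_interval x y" for z
      proof -
        have N_eq: "?N x z = - ?s x z * ?N x z"
          using twist[of x z] z unfolding mem_open_interval by blast
        have "\<rho> y - \<rho> z < \<rho> y - \<rho> x"
          using rank_open_interval[OF z] by linarith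
        hence "?M z y = ?s z y"
          using less.hyps z unfolding mem_open_interval by blast
        hence "?M z y = ?s x y * ?s x z"
          unfolding sign_rank_split[OF z] .
        hence "?N x z * ?M z y = ?s x y * (?s x z * ?N x z)"
          by (simp only: mult_ac)
        also have "?s x z * ?N x z = - ?N x z"
          using N_eq by linarith
        finally show ?thesis
          by simp
      qed
      hence "?M x y = ?N x y - ?s x y * (a * (\<Sum>z\<in>open_interval x y. ?N x z))"
        unfolding M[OF less.prems]
        by (simp add: sum_negf flip: sum_distrib_left)
      also have "a * (\<Sum>z\<in>open_interval x y. ?N x z) = - 1 - ?N x y"
        using N[OF less.prems] by simp
      finally show ?case
        using twist[OF less.prems] by (simp add: algebra_simps)
    qed
    thus "k_Eulerian k P r \<rho>"
      unfolding k_Eulerian_def using k_moebius_refl by force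
  }
qed

section \<open>Weighted chain sums as Moebius values\<close>

text \<open>The faces of the order complex of the open interval, including the empty face.\<close>

definition open_chains :: "'a \<Rightarrow> 'a \<Rightarrow> 'a set set" where
  "open_chains x y = {C. C \<subseteq> open_interval x y \<and> C \<in> Chains r}"

lemma finite_open_chains: "finite (open_chains x y)"
  by (rule finite_subset[of _ "Pow (open_interval x y)"])
    (auto simp: open_chains_def finite_open_interval)

lemma inj_on_rank_chain: "C \<in> Chains r \<Longrightarrow> inj_on \<rho> C"
  unfolding inj_on_def Chains_def by (fastforce dest: rank_less)

text \<open>An element of maximal rank works: it is comparable to every other element and cannot lie
  strictly below one.\<close>

lemma chain_has_greatest:
  assumes "finite C" "C \<noteq> {}" "C \<in> Chains r"
  obtains z where "z \<in> C" "\<And>w. w \<in> C \<Longrightarrow> (w, z) \<in> r"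
proof -
  obtain z where z: "z \<in> C" "\<And>w. w \<in> C \<Longrightarrow> \<rho> w \<le> \<rho> z"
    using assms(1,2) Max_in[of "\<rho> ` C"] Max_ge[of "\<rho> ` C"]
    by (metis (no_types, lifting) finite_imageI image_iff image_is_empty)
  have "(w, z) \<in> r" if "w \<in> C" for w
    using assms(3) z that rank_less[of z w] unfolding Chains_def by force
  with z(1) show ?thesis using that by blast
qed

text \<open>A nonempty chain is classified by its greatest element z; what remains is a chain
  strictly between x and z.\<close>

lemma open_chains_Union:
  assumes "(x, y) \<in> r" "x \<noteq> y"
  shows "open_chains x y =
    insert {} (\<Union>z\<in>open_interval x y. insert z ` open_chains x z)" (is "_ = ?R")
proof (rule set_eqI, rule iffI)
  fix C assume C: "C \<in> open_chains x y"
  show "C \<in> ?R"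
  proof (cases "C = {}")
    case False
    have "finite C"
      using C finite_subset[OF _ finite_open_interval] by (auto simp: open_chains_def)
    then obtain z where z: "z \<in> C" "\<And>w. w \<in> C \<Longrightarrow> (w, z) \<in> r"
      using chain_has_greatest[of C] C False by (auto simp: open_chains_def)
    have "C - {z} \<in> open_chains x z"
      using C z by (auto simp: open_chains_def Chains_def mem_open_interval)
    moreover have "C = insert z (C - {z})" "z \<in> open_interval x y"
      using z(1) C by (auto simp: open_chains_def)
    ultimately show ?thesis by blast
  qed simp
next
  fix C assume "C \<in> ?R"
  then consider "C = {}" | z D where "z \<in> open_interval x y" "D \<in> open_chains x z" "C = insert z D"
    by blast
  thus "C \<in> open_chains x y"
  proof cases
    case 1
    thus ?thesis by (simp add: open_chains_def Chains_def)
  next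
    case 2
    have "D \<subseteq> open_interval x y"
      using 2(1,2) r_trans r_antisym unfolding open_chains_def mem_open_interval subset_iff
      by blast
    moreover have "insert z D \<in> Chains r"
      using 2(1,2) r_refl r_in unfolding open_chains_def Chains_def mem_open_interval subset_iff
      by blast
    ultimately show ?thesis
      using 2 by (simp add: open_chains_def)
  qed
qed

lemma sum_open_chains_rec:
  fixes c :: real
  assumes "(x, y) \<in> r" "x \<noteq> y"
  shows "(\<Sum>C\<in>open_chains x y. c ^ card C) =
    1 + c * (\<Sum>z\<in>open_interval x y. \<Sum>C\<in>open_chains x z. c ^ card C)"
proof -
  have below: "(w, z) \<in> r \<and> w \<noteq> z" if "C \<in> open_chains x z" "w \<in> C" for C w z
    using that by (auto simp: open_chains_def mem_open_interval)
  have fin: "finite C" if "C \<in> open_chains x z" for C z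
    using that finite_subset[OF _ finite_open_interval] by (auto simp: open_chains_def)
  \<comment> \<open>If z and z' both topped the same chain, each would lie below the other.\<close>
  have disj: "insert z ` open_chains x z \<inter> insert z' ` open_chains x z' = {}" if "z \<noteq> z'" for z z'
  proof (rule ccontr)
    assume "\<not> ?thesis"
    then obtain C D where CD: "C \<in> open_chains x z" "D \<in> open_chains x z'" "insert z C = insert z' D"
      by blast
    hence "z \<in> D" "z' \<in> C"
      using that by auto
    thus False
      using below CD(1,2) r_antisym by blast
  qed
  \<comment> \<open>The summand 1 comes from the empty chain.\<close>
  have "(\<Sum>C\<in>open_chains x y. c ^ card C) =
    1 + (\<Sum>C\<in>(\<Union>z\<in>open_interval x y. insert z ` open_chains x z). c ^ card C)"
    unfolding open_chains_Union[OF assms]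
    by (subst sum.insert) (auto simp: finite_open_interval finite_open_chains)
  also have "(\<Sum>C\<in>(\<Union>z\<in>open_interval x y. insert z ` open_chains x z). c ^ card C) =
    (\<Sum>z\<in>open_interval x y. \<Sum>C\<in>insert z ` open_chains x z. c ^ card C)"
    using disj by (intro sum.UNION_disjoint) (auto simp: finite_open_interval finite_open_chains)
  also have "\<dots> = (\<Sum>z\<in>open_interval x y. \<Sum>C\<in>open_chains x z. c * c ^ card C)"
  proof (rule sum.cong[OF refl])
    fix z assume "z \<in> open_interval x y"
    have notin: "z \<notin> C" if "C \<in> open_chains x z" for C
      using below that by blast
    hence "inj_on (insert z) (open_chains x z)"
      by (metis inj_onI insert_ident)
    hence "(\<Sum>C\<in>insert z ` open_chains x z. c ^ card C) =
      (\<Sum>C\<in>open_chains x z. c ^ card (insert z C))"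
      by (simp add: sum.reindex)
    also have "\<dots> = (\<Sum>C\<in>open_chains x z. c * c ^ card C)"
      by (rule sum.cong[OF refl]) (simp add: notin fin)
    finally show "(\<Sum>C\<in>insert z ` open_chains x z. c ^ card C) =
      (\<Sum>C\<in>open_chains x z. c * c ^ card C)" .
  qed
  finally show ?thesis
    by (simp add: sum_distrib_left)
qed

text \<open>A weighted form of Philip Hall's theorem: for c = -1/k the chain recursion is the
  negated Moebius recursion.\<close>

lemma sum_open_chains_eq_k_moebius:
  assumes "(x, y) \<in> r" "x \<noteq> y"
  shows "(\<Sum>C\<in>open_chains x y. (- 1 / k) ^ card C) = - k_moebius k P r x y"
  using assms
proof (induction "\<rho> y" arbitrary: y rule: less_induct)
  case less
  have "(\<Sum>C\<in>open_chains x z. (- 1 / k) ^ card C) = - k_moebius k P r x z"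
    if "z \<in> open_interval x y" for z
    using less.hyps[of z] rank_open_interval[OF that] that unfolding mem_open_interval by blast
  thus ?case
    unfolding sum_open_chains_rec[OF less.prems] k_moebius_rec[OF less.prems]
    by (simp add: sum_negf)
qed

section \<open>Flag numbers as chain counts\<close>

text \<open>Chains are grouped by rank set; elements of a chain have distinct ranks, so the
  exponents \<open>card T\<close> and \<open>card C\<close> agree.\<close>

lemma sum_flag_f_eq_sum_open_chains:
  fixes c :: real
  assumes "(x, y) \<in> r"
  shows "(\<Sum>T | T \<subseteq> {1..\<rho> y - \<rho> x - 1}. c ^ card T *
      real (flag_f (interval P r x y) (interval_rel P r x y) (interval_rank \<rho> x) T)) =
    (\<Sum>C\<in>open_chains x y. c ^ card C)"
proof -
  let ?I = "interval P r x y" and ?\<rho> = "interval_rank \<rho> x" and ?m = "\<rho> y - \<rho> x"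
  \<comment> \<open>The endpoints have relative ranks 0 and m, so the range 1 to m - 1 excludes
    exactly them; for m = 0 it is empty, as is the open interval.\<close>
  have inner: "z \<in> open_interval x y \<longleftrightarrow> z \<in> ?I \<and> ?\<rho> z \<in> {1..?m - 1}" for z
    using rank_open_interval[of z x y]
    by (auto simp: interval_rank_def open_interval_def)
  have chains: "{C. C \<subseteq> ?I \<and> C \<in> Chains (interval_rel P r x y) \<and> ?\<rho> ` C = T} =
      {C \<in> open_chains x y. ?\<rho> ` C = T}" if "T \<subseteq> {1..?m - 1}" for T
  proof -
    have "C \<subseteq> ?I \<and> C \<in> Chains (interval_rel P r x y) \<longleftrightarrow> C \<in> open_chains x y"
      if C: "?\<rho> ` C = T" for C
    proof -
      have sub: "C \<subseteq> ?I \<longleftrightarrow> C \<subseteq> open_interval x y"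
        using \<open>T \<subseteq> {1..?m - 1}\<close> C inner by blast
      have "C \<in> Chains (interval_rel P r x y) \<longleftrightarrow> C \<in> Chains r" if "C \<subseteq> ?I"
        using that unfolding Chains_def interval_rel_def by blast
      thus ?thesis
        unfolding open_chains_def mem_Collect_eq sub[symmetric] by (rule conj_cong[OF refl])
    qed
    thus ?thesis
      by (intro Collect_cong) metis
  qed
  have card: "card (?\<rho> ` C) = card C" if "C \<in> open_chains x y" for C
  proof (rule card_image)
    have inj: "inj_on \<rho> C" and above: "\<And>z. z \<in> C \<Longrightarrow> \<rho> x < \<rho> z"
      using that inj_on_rank_chain rank_open_interval unfolding open_chains_def by blast+
    \<comment> \<open>All ranks in C exceed that of x, so the truncated subtraction in
      \<open>interval_rank\<close> loses nothing.\<close>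
    show "inj_on ?\<rho> C"
    proof (rule inj_onI)
      fix v w assume vw: "v \<in> C" "w \<in> C" "?\<rho> v = ?\<rho> w"
      hence "\<rho> v = \<rho> w"
        using above[OF vw(1)] above[OF vw(2)] unfolding interval_rank_def by linarith
      thus "v = w"
        using inj vw(1,2) by (simp add: inj_on_def)
    qed
  qed
  have "(\<Sum>T | T \<subseteq> {1..?m - 1}. c ^ card T * real (flag_f ?I (interval_rel P r x y) ?\<rho> T)) =
    (\<Sum>T\<in>Pow {1..?m - 1}. \<Sum>C | C \<in> open_chains x y \<and> ?\<rho> ` C = T. c ^ card C)"
  proof (rule sum.cong)
    fix T assume "T \<in> Pow {1..?m - 1}"
    hence "flag_f ?I (interval_rel P r x y) ?\<rho> T = card {C \<in> open_chains x y. ?\<rho> ` C = T}"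
      unfolding flag_f_def by (simp add: chains)
    moreover have "(\<Sum>C | C \<in> open_chains x y \<and> ?\<rho> ` C = T. c ^ card C) =
      (\<Sum>C | C \<in> open_chains x y \<and> ?\<rho> ` C = T. c ^ card T)"
      using card by (intro sum.cong) auto
    ultimately show "c ^ card T * real (flag_f ?I (interval_rel P r x y) ?\<rho> T) =
      (\<Sum>C | C \<in> open_chains x y \<and> ?\<rho> ` C = T. c ^ card C)"
      by simp
  qed auto
  also have "\<dots> = (\<Sum>C\<in>open_chains x y. c ^ card C)"
  proof (rule sum.group)
    show "image ?\<rho> ` open_chains x y \<subseteq> Pow {1..?m - 1}"
      using inner by (fastforce simp: open_chains_def)
  qed (simp_all add: finite_open_chains)
  finally show ?thesis .
qed

end

section \<open>Graded posets and the final equivalence\<close>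

text \<open>Supplies the locale assumption. A pair that is not a cover has an intermediate element,
  which splits its interval into two with fewer elements.\<close>

lemma graded_poset_rank_less:
  assumes "graded_poset P r \<rho>" "(x, y) \<in> r" "x \<noteq> y"
  shows "\<rho> x < \<rho> y"
proof -
  have fin: "finite P" and po: "partial_order_on P r"
    and cov: "\<And>x y. covers P r y x \<Longrightarrow> \<rho> y = \<rho> x + 1"
    using assms(1) by (auto simp: graded_poset_def)
  have r: "trans r" "antisym r" "\<And>x y. (x, y) \<in> r \<Longrightarrow> x \<in> P \<and> y \<in> P"
    using po by (auto simp: partial_order_on_def preorder_on_def refl_on_def)
  have fin_int: "finite (interval P r u v)" for u v
    using fin by (simp add: interval_def)
  show ?thesis
    using assms(2,3)
  proof (induction "card (interval P r x y)" arbitrary: x y rule: less_induct)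
    case less
    show ?case
    proof (cases "covers P r y x")
      case True
      thus ?thesis using cov by fastforce
    next
      case False
      then obtain z where z: "(x, z) \<in> r" "(z, y) \<in> r" "z \<noteq> x" "z \<noteq> y"
        using less.prems r(3) unfolding covers_def by blast
      have "\<not> (y, z) \<in> r" "\<not> (z, x) \<in> r"
        using z antisymD[OF r(2)] by blast+
      moreover have "(x, x) \<in> r" "(y, y) \<in> r"
        using less.prems r(3) po by (auto simp: partial_order_on_def preorder_on_def refl_on_def)
      ultimately have "interval P r x z \<subset> interval P r x y" "interval P r z y \<subset> interval P r x y"
        using z less.prems r(3) transD[OF r(1)] unfolding interval_def by blast+
      hence "\<rho> x < \<rho> z" "\<rho> z < \<rho> y"
        using less.hyps z fin_int psubset_card_mono by metis+
      thus ?thesis by simp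
    qed
  qed
qed

text \<open>For S = [1,m-1] the sign exponent is 0 and the complement of S is empty. This gives the
  first equality of the final statement.\<close>

lemma flag_L_full:
  "flag_L k m {1..m - 1} Q r \<rho> =
    (\<Sum>T | T \<subseteq> {1..m - 1}. (- 1 / (2 * k)) ^ card T * real (flag_f Q r \<rho> T))"
  by (simp add: flag_L_def)

theorem mainTheorem9:
  fixes k :: real and P :: "'a set" and r :: "'a rel" and \<rho> :: "'a \<Rightarrow> nat"
  assumes "k > 0" and "graded_poset P r \<rho>"
  shows "k_Eulerian k P r \<rho> \<longleftrightarrow>
    (\<forall>x\<in>P. \<forall>y\<in>P. \<forall>m. (x, y) \<in> r \<and> m = \<rho> y - \<rho> x \<and> 0 < m \<and> even m \<longrightarrow>
      flag_L k m {1..m - 1} (interval P r x y) (interval_rel P r x y) (interval_rank \<rho> x) =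
        (\<Sum>T | T \<subseteq> {1..m - 1}. (- 1 / (2 * k)) ^ card T *
           real (flag_f (interval P r x y) (interval_rel P r x y) (interval_rank \<rho> x) T)) \<and>
      (\<Sum>T | T \<subseteq> {1..m - 1}. (- 1 / (2 * k)) ^ card T *
           real (flag_f (interval P r x y) (interval_rel P r x y) (interval_rank \<rho> x) T)) = 0)"
proof -
  interpret ranked_finite_poset P r \<rho>
    using assms(2) graded_poset_rank_less[OF assms(2)]
    by unfold_locales (auto simp: graded_poset_def)
  let ?F = "\<lambda>x y. \<Sum>T | T \<subseteq> {1..\<rho> y - \<rho> x - 1}. (- 1 / (2 * k)) ^ card T *
    real (flag_f (interval P r x y) (interval_rel P r x y) (interval_rank \<rho> x) T)"
  \<comment> \<open>The chain sum has weight -1/(2k), so Hall's formula is taken at 2k.\<close>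
  have F: "?F x y = - k_moebius (2 * k) P r x y" if "(x, y) \<in> r" "x \<noteq> y" for x y
    using sum_flag_f_eq_sum_open_chains[OF that(1)] sum_open_chains_eq_k_moebius[OF that]
    by simp
  have pos: "0 < \<rho> y - \<rho> x \<longleftrightarrow> x \<noteq> y" if "(x, y) \<in> r" for x y
    using rank_less[OF that] by auto
  have "k_Eulerian k P r \<rho> \<longleftrightarrow>
    (\<forall>x y. (x, y) \<in> r \<and> x \<noteq> y \<and> even (\<rho> y - \<rho> x) \<longrightarrow> k_moebius (2 * k) P r x y = 0)"
    using assms(1) by (intro k_Eulerian_iff_k_moebius_double_eq_0) simp
  also have "\<dots> \<longleftrightarrow> (\<forall>x\<in>P. \<forall>y\<in>P. (x, y) \<in> r \<and> 0 < \<rho> y - \<rho> x \<and> even (\<rho> y - \<rho> x) \<longrightarrow> ?F x y = 0)"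
  proof -
    have "?F x y = 0 \<longleftrightarrow> k_moebius (2 * k) P r x y = 0" if "(x, y) \<in> r" "x \<noteq> y" for x y
      unfolding F[OF that] by simp
    thus ?thesis
      using pos r_in by blast
  qed
  finally show ?thesis
    unfolding flag_L_full by blast
qed

end
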